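(* Let $\mathcal{H}$ be a complex separable Hilbert space and let $\mathcal{M},\mathcal{N}$ be operator ranges in $\mathcal{H}$ such that $\mathcal{M}\cap\mathcal{N}$ is closed in $\mathcal{M}+\mathcal{N}$ (in the relative topology). Then there exist bounded positive (semi-definite) operators $X,P_0$ on the Hilbert space $\overline{\mathcal{M}+\mathcal{N}}$, with $X$ a quasi-affinity and $P_0$ a projection, and a closed subspace $\mathcal{S}$ of $\overline{\mathcal{M}+\mathcal{N}}$, such that $$P_{\mathcal{M},\mathcal{N}}X=X\bigl(P_0\ \hat{\oplus}\ (\{0\}\times\mathcal{S})\bigr).$$
   Context: A linear relation on a Hilbert space $\mathcal{K}$ is a linear subspace of $\mathcal{K}\times\mathcal{K}$; operators are identified with their graphs. The product of relations is $RT=\{(x,y):(x,z)\in T,(z,y)\in R\text{ for some }z\}$. $T\,\hat{\oplus}\,S$ is the sum of $T$ and $S$ as subspaces of $\mathcal{K}\times\mathcal{K}$, with $T$ and $S$ orthogonal in $\mathcal{K}\times\mathcal{K}$. An operator range is a linear subspace which is the range of a bounded operator on the Hilbert space. For subspaces $\mathcal{M},\mathcal{N}$, $P_{\mathcal{M},\mathcal{N}}=\{(m+n,m):m\in\mathcal{M},n\in\mathcal{N}\}$; here it is regarded as a linear relation on $\overline{\mathcal{M}+\mathcal{N}}$. A quasi-affinity is a bounded operator that is injective with dense range. A projection is an idempotent operator. *)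

theory Defs
  imports "HOL-Analysis.Analysis" "HOL-Library.Set_Algebras"
begin

class scaleC =
  fixes scaleC :: "complex \<Rightarrow> 'a \<Rightarrow> 'a"  (infixr \<open>*\<^sub>C\<close> 75)

class complex_vector = real_vector + scaleC +
  assumes scaleC_add_right: "a *\<^sub>C (x + y) = a *\<^sub>C x + a *\<^sub>C y"
    and scaleC_add_left: "(a + b) *\<^sub>C x = a *\<^sub>C x + b *\<^sub>C x"
    and scaleC_scaleC: "a *\<^sub>C b *\<^sub>C x = (a * b) *\<^sub>C x"
    and scaleC_one: "1 *\<^sub>C x = x"
    and scaleR_scaleC: "r *\<^sub>R x = complex_of_real r *\<^sub>C x"

global_interpretation complex_vector:
  vector_space "scaleC :: complex \<Rightarrow> 'a \<Rightarrow> 'a::complex_vector"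
  defines csubspace = complex_vector.subspace
  by unfold_locales
    (simp_all add: scaleC_add_right scaleC_add_left scaleC_scaleC scaleC_one)

text \<open>The complex inner product is linear in its first argument.  Its real part is the
  real inner product inherited from \<^class>\<open>real_inner\<close>, so norm and topology are the
  ones induced by \<open>cinner\<close>.\<close>

class complex_inner = complex_vector + real_inner +
  fixes cinner :: "'a \<Rightarrow> 'a \<Rightarrow> complex"
  assumes cinner_commute: "cinner x y = cnj (cinner y x)"
    and cinner_add_left: "cinner (x + y) z = cinner x z + cinner y z"
    and cinner_scaleC_left: "cinner (a *\<^sub>C x) y = a * cinner x y"
    and Re_cinner: "Re (cinner x y) = inner x y"

class complex_hilbert_space = complex_inner + complete_space

instantiation complex :: complex_hilbert_space
begin

definition scaleC_complex :: "complex \<Rightarrow> complex \<Rightarrow> complex" where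
  "scaleC_complex a z = a * z"

definition cinner_complex :: "complex \<Rightarrow> complex \<Rightarrow> complex" where
  "cinner_complex z w = z * cnj w"

instance
  by standard
    (simp_all add: scaleC_complex_def cinner_complex_def inner_complex_def algebra_simps
      scaleR_conv_of_real)

end

instantiation prod :: (complex_vector, complex_vector) complex_vector
begin

definition scaleC_prod :: "complex \<Rightarrow> 'a \<times> 'b \<Rightarrow> 'a \<times> 'b" where
  "scaleC_prod a p = (a *\<^sub>C fst p, a *\<^sub>C snd p)"

instance
  by standard
    (simp_all add: scaleC_prod_def prod_eq_iff scaleC_add_right scaleC_add_left
      scaleC_scaleC scaleC_one scaleR_scaleC)

end

instantiation prod :: (complex_inner, complex_inner) complex_inner
begin

definition cinner_prod :: "'a \<times> 'b \<Rightarrow> 'a \<times> 'b \<Rightarrow> complex" where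
  "cinner_prod p q = cinner (fst p) (fst q) + cinner (snd p) (snd q)"

instance
proof
  fix x y z :: "'a \<times> 'b" and a :: complex
  show "cinner x y = cnj (cinner y x)"
    unfolding cinner_prod_def complex_cnj_add by (metis cinner_commute)
qed (simp_all add: cinner_prod_def scaleC_prod_def cinner_add_left cinner_scaleC_left
      Re_cinner inner_prod_def algebra_simps)

end

instance prod :: (complex_hilbert_space, complex_hilbert_space) complex_hilbert_space ..

text \<open>Operators on a closed subspace \<open>K\<close>, regarded as a Hilbert space in its own right,
  are represented by functions on the ambient type; only their values on \<open>K\<close> matter.\<close>

definition bounded_operator_on :: "'a::complex_inner set \<Rightarrow> ('a \<Rightarrow> 'a) \<Rightarrow> bool" where
  "bounded_operator_on K A \<longleftrightarrow>
     A ` K \<subseteq> K \<and>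
     (\<forall>x\<in>K. \<forall>y\<in>K. A (x + y) = A x + A y) \<and>
     (\<forall>c. \<forall>x\<in>K. A (c *\<^sub>C x) = c *\<^sub>C A x) \<and>
     (\<exists>B. \<forall>x\<in>K. norm (A x) \<le> B * norm x)"

definition positive_on :: "'a::complex_inner set \<Rightarrow> ('a \<Rightarrow> 'a) \<Rightarrow> bool" where
  "positive_on K A \<longleftrightarrow> (\<forall>x\<in>K. cinner (A x) x \<in> \<real> \<and> 0 \<le> Re (cinner (A x) x))"

definition quasi_affinity_on :: "'a::complex_inner set \<Rightarrow> ('a \<Rightarrow> 'a) \<Rightarrow> bool" where
  "quasi_affinity_on K A \<longleftrightarrow> bounded_operator_on K A \<and> inj_on A K \<and> K \<subseteq> closure (A ` K)"

definition idempotent_on :: "'a set \<Rightarrow> ('a \<Rightarrow> 'a) \<Rightarrow> bool" where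
  "idempotent_on K A \<longleftrightarrow> (\<forall>x\<in>K. A (A x) = A x)"

definition operator_range :: "'a::complex_inner set \<Rightarrow> bool" where
  "operator_range M \<longleftrightarrow> (\<exists>A. bounded_operator_on UNIV A \<and> M = range A)"

definition graph_on :: "'a set \<Rightarrow> ('a \<Rightarrow> 'a) \<Rightarrow> ('a \<times> 'a) set" where
  "graph_on K A = {(x, A x) | x. x \<in> K}"

text \<open>The product \<open>R T\<close> applies \<open>T\<close> first, whereas \<open>(O)\<close> composes from left to right.\<close>

definition rel_product :: "('a \<times> 'a) set \<Rightarrow> ('a \<times> 'a) set \<Rightarrow> ('a \<times> 'a) set"
    (infixr \<open>\<bullet>\<^sub>r\<close> 75) where
  "R \<bullet>\<^sub>r T = T O R"

definition corthogonal_sets :: "'a::complex_inner set \<Rightarrow> 'a set \<Rightarrow> bool" where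
  "corthogonal_sets T S \<longleftrightarrow> (\<forall>p\<in>T. \<forall>q\<in>S. cinner p q = 0)"

definition proj_rel :: "'a::plus set \<Rightarrow> 'a set \<Rightarrow> ('a \<times> 'a) set" where
  "proj_rel M N = {(m + n, m) | m n. m \<in> M \<and> n \<in> N}"

end

theory Submission
  imports Defs
begin

text \<open>Write \<open>M = ran A\<close>, \<open>N = ran B\<close>, let \<open>D = B\<^sup>-\<^sup>1(M)\<close>, closed because \<open>M \<inter> N\<close> is closed in
  \<open>M + N\<close>, and let \<open>Q\<close> be the orthogonal projection onto the complement of \<open>D\<close>.
  The operator \<open>T (u, v) = A u + B (Q v)\<close> has range \<open>M + N\<close>, and on the orthogonal
  complement \<open>L\<close> of its kernel the preimages of \<open>M\<close> and \<open>N\<close> are orthogonal sums of their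
  intersection with two subspaces orthogonal to each other.  The polar decomposition turns
  \<open>T\<close> on \<open>L\<close> into the positive operator \<open>X = (T T\<^sup>*)\<^sup>1\<^sup>/\<^sup>2\<close> composed with a unitary from
  \<open>L\<close> onto \<open>K\<close>, so that the same orthogonality holds for the preimages of \<open>M\<close> and \<open>N\<close>
  under \<open>X\<close>.  Then \<open>S\<close> is the preimage of \<open>M \<inter> N\<close> and \<open>P0\<close> the projection onto
  the part of the preimage of \<open>M\<close> orthogonal to \<open>S\<close>.

  Everything is done for the real inner product; complex linearity enters as commutation
  with all maps \<open>scaleC c\<close>.\<close>

text \<open>Makes everything proved for \<open>{real_inner,banach}\<close> available on complex
  Hilbert spaces.\<close>

instance complex_hilbert_space \<subseteq> banach ..

section \<open>Orthogonal complements and projections onto closed subspaces\<close>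

lemma closed_orthogonal_comp: "closed (W\<^sup>\<bottom>)"
proof -
  have "W\<^sup>\<bottom> = (\<Inter>y\<in>W. {x. y \<bullet> x = 0})"
    by (auto simp: orthogonal_comp_def orthogonal_def)
  moreover have "closed {x. y \<bullet> x = 0}" for y :: 'a
    by (intro closed_Collect_eq continuous_intros)
  ultimately show ?thesis
    by (simp add: closed_INT)
qed

lemma orthogonal_compI: "(\<And>y. y \<in> W \<Longrightarrow> y \<bullet> x = 0) \<Longrightarrow> x \<in> W\<^sup>\<bottom>"
  by (auto simp: orthogonal_comp_def orthogonal_def)

lemma orthogonal_compD: "x \<in> W\<^sup>\<bottom> \<Longrightarrow> y \<in> W \<Longrightarrow> x \<bullet> y = 0" "x \<in> W\<^sup>\<bottom> \<Longrightarrow> y \<in> W \<Longrightarrow> y \<bullet> x = 0"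
  by (auto simp: orthogonal_comp_def orthogonal_def inner_commute)

text \<open>A minimizing sequence is Cauchy by the parallelogram law, and its limit stays in the
  closed set \<open>V\<close>.\<close>

lemma ex_nearest_point_closed_subspace:
  fixes V :: "'a::{real_inner,banach} set"
  assumes "subspace V" "closed V"
  shows "\<exists>p\<in>V. \<forall>v\<in>V. norm (x - p) \<le> norm (x - v)"
proof -
  define d where "d = infdist x V"
  have ne: "V \<noteq> {}" using subspace_0[OF assms(1)] by auto
  have d_le: "d \<le> norm (x - v)" if "v \<in> V" for v
    using infdist_le[OF that, of x] by (simp add: d_def dist_norm)
  have d0: "0 \<le> d" by (simp add: d_def infdist_nonneg)
  have "\<exists>v\<in>V. (norm (x - v))\<^sup>2 < d\<^sup>2 + inverse (real (Suc n))" for n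
  proof -
    have "d < sqrt (d\<^sup>2 + inverse (real (Suc n)))"
      using d0 by (intro real_less_rsqrt) simp
    then have "Inf (dist x ` V) < sqrt (d\<^sup>2 + inverse (real (Suc n)))"
      using ne by (simp add: d_def infdist_def)
    then obtain v where "v \<in> V" "dist x v < sqrt (d\<^sup>2 + inverse (real (Suc n)))"
      using ne cInf_lessD[of "dist x ` V"] by blast
    then show ?thesis
      using power_strict_mono[of "dist x v" "sqrt (d\<^sup>2 + inverse (real (Suc n)))" 2]
      by (intro bexI[of _ v]) (auto simp: dist_norm)
  qed
  then obtain v where v: "\<And>n. v n \<in> V" "\<And>n. (norm (x - v n))\<^sup>2 < d\<^sup>2 + inverse (real (Suc n))"
    by metis
  \<comment> \<open>Parallelogram law for \<open>x - v m\<close> and \<open>x - v n\<close>: the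
    midpoint of \<open>v m\<close> and \<open>v n\<close> lies in \<open>V\<close>, so its distance
    to \<open>x\<close> is at least \<open>d\<close>.\<close>
  have par: "(norm (v m - v n))\<^sup>2 \<le> 2 * (inverse (real (Suc m)) + inverse (real (Suc n)))" for m n
  proof -
    have "(1/2) *\<^sub>R (v m + v n) \<in> V"
      using v(1) assms(1) by (simp add: subspace_add subspace_scale)
    then have "d\<^sup>2 \<le> (norm (x - (1/2) *\<^sub>R (v m + v n)))\<^sup>2"
      using d0 d_le by (intro power_mono) auto
    moreover have "(norm (v m - v n))\<^sup>2 = 2 * (norm (x - v m))\<^sup>2 + 2 * (norm (x - v n))\<^sup>2
        - 4 * (norm (x - (1/2) *\<^sub>R (v m + v n)))\<^sup>2"
      by (simp add: power2_norm_eq_inner inner_commute algebra_simps)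
    ultimately show ?thesis
      using v(2)[of m] v(2)[of n] by argo
  qed
  have "Cauchy v"
  proof (rule metric_CauchyI)
    fix e :: real assume "e > 0"
    then obtain k where k: "inverse (real (Suc k)) < e\<^sup>2 / 4"
      using reals_Archimedean[of "e\<^sup>2/4"] by auto
    have "dist (v m) (v n) < e" if "m \<ge> k" "n \<ge> k" for m n
    proof -
      have "inverse (real (Suc m)) \<le> inverse (real (Suc k))" "inverse (real (Suc n)) \<le> inverse (real (Suc k))"
        using that by auto
      then have "(norm (v m - v n))\<^sup>2 < e\<^sup>2"
        using par[of m n] k by argo
      then show ?thesis
        using \<open>e > 0\<close> by (simp add: dist_norm power2_less_imp_less)
    qed
    then show "\<exists>k. \<forall>m\<ge>k. \<forall>n\<ge>k. dist (v m) (v n) < e" by blast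
  qed
  then obtain p where p: "v \<longlonglongrightarrow> p"
    using Cauchy_convergent_iff convergentD by metis
  have "(norm (x - p))\<^sup>2 \<le> d\<^sup>2"
  proof (rule LIMSEQ_le)
    show "(\<lambda>n. (norm (x - v n))\<^sup>2) \<longlonglongrightarrow> (norm (x - p))\<^sup>2"
      by (intro tendsto_intros p)
    show "(\<lambda>n. d\<^sup>2 + inverse (real (Suc n))) \<longlonglongrightarrow> d\<^sup>2"
      using tendsto_add[OF tendsto_const LIMSEQ_inverse_real_of_nat, of "d\<^sup>2"] by simp
  qed (use v(2) less_imp_le in blast)
  then have "norm (x - p) \<le> d"
    using d0 power2_le_imp_le by blast
  moreover have "p \<in> V"
    using closed_sequentially[OF assms(2)] v(1) p by blast
  ultimately show ?thesis
    using d_le by force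
qed

text \<open>The nearest point works: if the residual were not orthogonal to some \<open>v\<close>,
  moving along \<open>v\<close> would come closer to \<open>x\<close>.\<close>

lemma ex_orthogonal_projection:
  fixes V :: "'a::{real_inner,banach} set"
  assumes "subspace V" "closed V"
  shows "\<exists>p\<in>V. x - p \<in> V\<^sup>\<bottom>"
proof -
  obtain p where p: "p \<in> V" "\<And>v. v \<in> V \<Longrightarrow> norm (x - p) \<le> norm (x - v)"
    using ex_nearest_point_closed_subspace[OF assms] by blast
  have "v \<bullet> (x - p) = 0" if v: "v \<in> V" for v
  proof (rule ccontr)
    define a where "a = v \<bullet> (x - p)"
    assume "v \<bullet> (x - p) \<noteq> 0"
    then have a: "a \<noteq> 0" "v \<noteq> 0" by (auto simp: a_def)
    \<comment> \<open>This \<open>t\<close> minimizes the quadratic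
      \<open>norm (x - (p + t *\<^sub>R v))\<close> squared and lowers it by
      \<open>a\<^sup>2 / (v \<bullet> v)\<close>.\<close>
    define t where "t = a / (v \<bullet> v)"
    have "p + t *\<^sub>R v \<in> V"
      using p(1) v assms(1) by (simp add: subspace_add subspace_scale)
    then have "(norm (x - p))\<^sup>2 \<le> (norm (x - (p + t *\<^sub>R v)))\<^sup>2"
      using p(2) by (intro power_mono) auto
    also have "\<dots> = (norm (x - p))\<^sup>2 - 2 * t * a + t\<^sup>2 * (v \<bullet> v)"
      unfolding a_def power2_norm_eq_inner
      by (simp add: inner_commute algebra_simps power2_eq_square)
    also have "\<dots> = (norm (x - p))\<^sup>2 - a\<^sup>2 / (v \<bullet> v)"
      using a by (simp add: t_def power2_eq_square field_simps)
    finally show False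
      using a by (simp add: divide_le_0_iff flip: inner_gt_zero_iff)
  qed
  then show ?thesis
    using p(1) by (blast intro: orthogonal_compI)
qed

text \<open>Choice makes the map total for arbitrary \<open>V\<close>; for a closed subspace of a
  complete space the chosen point exists and is unique.\<close>

definition orth_proj :: "'a::real_inner set \<Rightarrow> 'a \<Rightarrow> 'a" where
  "orth_proj V x = (SOME p. p \<in> V \<and> x - p \<in> V\<^sup>\<bottom>)"

context
  fixes V :: "'a::{real_inner,banach} set"
  assumes V: "subspace V" "closed V"
begin

lemma orth_proj_in: "orth_proj V x \<in> V"
  and orth_proj_diff: "x - orth_proj V x \<in> V\<^sup>\<bottom>"
proof -
  have "orth_proj V x \<in> V \<and> x - orth_proj V x \<in> V\<^sup>\<bottom>"
    unfolding orth_proj_def by (rule someI_ex) (use ex_orthogonal_projection[OF V] in blast)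
  then show "orth_proj V x \<in> V" "x - orth_proj V x \<in> V\<^sup>\<bottom>" by auto
qed

lemma orth_proj_unique:
  assumes "p \<in> V" "x - p \<in> V\<^sup>\<bottom>"
  shows "orth_proj V x = p"
proof -
  have "orth_proj V x - p \<in> V"
    using V assms orth_proj_in by (simp add: subspace_diff)
  moreover have "(x - p) - (x - orth_proj V x) \<in> V\<^sup>\<bottom>"
    by (intro subspace_diff subspace_orthogonal_comp assms orth_proj_diff)
  then have "orth_proj V x - p \<in> V\<^sup>\<bottom>" by simp
  ultimately have "(orth_proj V x - p) \<bullet> (orth_proj V x - p) = 0"
    by (blast dest: orthogonal_compD)
  then show ?thesis by simp
qed

lemma orth_proj_same: "x \<in> V \<Longrightarrow> orth_proj V x = x"
  by (rule orth_proj_unique) (simp_all add: subspace_0 subspace_orthogonal_comp)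

lemma orth_proj_inner: "orth_proj V x \<bullet> x = (norm (orth_proj V x))\<^sup>2"
  using orthogonal_compD(2)[OF orth_proj_diff orth_proj_in, of x x]
  by (simp add: inner_diff_right power2_norm_eq_inner)

lemma orth_proj_norm_le: "norm (orth_proj V x) \<le> norm x"
proof -
  have "norm (orth_proj V x) * norm (orth_proj V x) \<le> norm (orth_proj V x) * norm x"
    using orth_proj_inner[of x] norm_cauchy_schwarz[of "orth_proj V x" x]
    by (simp add: power2_eq_square)
  then show ?thesis by (cases "orth_proj V x = 0") auto
qed

lemma orth_proj_add: "orth_proj V (x + y) = orth_proj V x + orth_proj V y"
proof (rule orth_proj_unique)
  have "(x - orth_proj V x) + (y - orth_proj V y) \<in> V\<^sup>\<bottom>"
    by (intro subspace_add subspace_orthogonal_comp orth_proj_diff)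
  then show "x + y - (orth_proj V x + orth_proj V y) \<in> V\<^sup>\<bottom>"
    by (simp add: algebra_simps)
qed (intro subspace_add V orth_proj_in)

text \<open>\<open>J\<close> carries the orthogonal decomposition of \<open>x\<close> to one of
  \<open>J x\<close>, and decompositions are unique. Taking \<open>J\<close> to be a real or a
  complex scaling yields homogeneity.\<close>

lemma orth_proj_commute:
  assumes J: "linear J" "J ` V \<subseteq> V" "J ` (V\<^sup>\<bottom>) \<subseteq> V\<^sup>\<bottom>"
  shows "orth_proj V (J x) = J (orth_proj V x)"
proof (rule orth_proj_unique)
  show "J (orth_proj V x) \<in> V" using J(2) orth_proj_in by blast
  have "J (x - orth_proj V x) \<in> V\<^sup>\<bottom>" using J(3) orth_proj_diff by blast
  then show "J x - J (orth_proj V x) \<in> V\<^sup>\<bottom>" using J(1) by (simp add: linear_diff)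
qed

lemma bounded_linear_orth_proj: "bounded_linear (orth_proj V)"
proof (rule bounded_linear_intro[where K=1])
  show "orth_proj V (r *\<^sub>R x) = r *\<^sub>R orth_proj V x" for r x
    by (rule orth_proj_commute)
       (auto simp: V subspace_scale subspace_orthogonal_comp linear_scale_self)
qed (simp_all add: orth_proj_add orth_proj_norm_le)

lemma orthogonal_comp_orthogonal_comp: "V\<^sup>\<bottom>\<^sup>\<bottom> = V"
proof (rule antisym)
  show "V\<^sup>\<bottom>\<^sup>\<bottom> \<subseteq> V"
  proof
    fix x assume x: "x \<in> V\<^sup>\<bottom>\<^sup>\<bottom>"
    \<comment> \<open>The residual lies in the complement of \<open>V\<close> and in the complement
      of that complement, hence is orthogonal to itself.\<close>
    have "x - orth_proj V x \<in> V\<^sup>\<bottom>\<^sup>\<bottom>"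
      using x orth_proj_in orthogonal_comp_subset
      by (intro subspace_diff subspace_orthogonal_comp) blast+
    then have "(x - orth_proj V x) \<bullet> (x - orth_proj V x) = 0"
      using orth_proj_diff by (blast dest: orthogonal_compD)
    then show "x \<in> V" using orth_proj_in[of x] by simp
  qed
qed (rule orthogonal_comp_subset)

end

text \<open>The double complement of \<open>W\<close> is closed and contains \<open>W\<close>, hence
  contains \<open>closure W\<close>; complements reverse this inclusion.\<close>

lemma orthogonal_comp_closure: "(closure W)\<^sup>\<bottom> = W\<^sup>\<bottom>"
proof (rule antisym)
  have "closure W \<subseteq> W\<^sup>\<bottom>\<^sup>\<bottom>"
    by (intro closure_minimal orthogonal_comp_subset closed_orthogonal_comp)
  then show "W\<^sup>\<bottom> \<subseteq> (closure W)\<^sup>\<bottom>"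
    using orthogonal_comp_subset orthogonal_comp_anti_mono by blast
qed (simp add: orthogonal_comp_anti_mono closure_subset)

lemma subspace_closure:
  fixes W :: "'a::real_normed_vector set"
  assumes W: "subspace W"
  shows "subspace (closure W)"
  unfolding subspace_def
proof (intro conjI ballI allI)
  show "0 \<in> closure W" using subspace_0[OF W] closure_subset by blast
next
  fix x y assume "x \<in> closure W" "y \<in> closure W"
  then obtain f g where "\<forall>n. f n \<in> W" "f \<longlonglongrightarrow> x" "\<forall>n. g n \<in> W" "g \<longlonglongrightarrow> y"
    unfolding closure_sequential by blast
  then have "\<forall>n. f n + g n \<in> W" "(\<lambda>n. f n + g n) \<longlonglongrightarrow> x + y"
    using W by (auto intro: subspace_add tendsto_add)
  then show "x + y \<in> closure W"
    unfolding closure_sequential by (intro exI[of _ "\<lambda>n. f n + g n"]) simp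
next
  fix c x assume "x \<in> closure W"
  then obtain f where "\<forall>n. f n \<in> W" "f \<longlonglongrightarrow> x"
    unfolding closure_sequential by blast
  then have "\<forall>n. c *\<^sub>R f n \<in> W" "(\<lambda>n. c *\<^sub>R f n) \<longlonglongrightarrow> c *\<^sub>R x"
    using W by (auto intro: subspace_scale tendsto_scaleR)
  then show "c *\<^sub>R x \<in> closure W"
    unfolding closure_sequential by (intro exI[of _ "\<lambda>n. c *\<^sub>R f n"]) simp
qed

lemma orthogonal_comp_orthogonal_comp_closure:
  fixes W :: "'a::{real_inner,banach} set"
  assumes "subspace W"
  shows "W\<^sup>\<bottom>\<^sup>\<bottom> = closure W"
  using orthogonal_comp_orthogonal_comp[of "closure W"] assms
  by (simp add: orthogonal_comp_closure subspace_closure)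

section \<open>Riesz representation and adjoints of bounded operators\<close>

lemma riesz_representation:
  fixes f :: "'a::{real_inner,banach} \<Rightarrow> real"
  assumes "bounded_linear f"
  shows "\<exists>w. \<forall>x. f x = x \<bullet> w"
proof (cases "\<forall>x. f x = 0")
  case False
  interpret f: bounded_linear f by fact
  define V where "V = {x. f x = 0}"
  have V: "subspace V" "closed V"
    unfolding V_def
    by (simp_all add: subspace_def f.zero f.add f.scale closed_Collect_eq
        f.continuous_on continuous_on_id)
  from False obtain x0 where x0: "f x0 \<noteq> 0" by blast
  define z where "z = x0 - orth_proj V x0"
  have z: "z \<in> V\<^sup>\<bottom>" unfolding z_def by (rule orth_proj_diff[OF V])
  have fz: "f z \<noteq> 0"
    using x0 orth_proj_in[OF V, of x0] by (simp add: z_def f.diff V_def)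
  then have "z \<noteq> 0" using f.zero by auto
  \<comment> \<open>Subtracting the right multiple of \<open>z\<close> moves \<open>x\<close> into
    the kernel of \<open>f\<close>, to which \<open>z\<close> is orthogonal.\<close>
  have "f x = x \<bullet> ((f z / (z \<bullet> z)) *\<^sub>R z)" for x
  proof -
    have "x - (f x / f z) *\<^sub>R z \<in> V"
      using fz by (simp add: V_def f.diff f.scale)
    from orthogonal_compD(2)[OF z this] show ?thesis
      using fz \<open>z \<noteq> 0\<close> by (simp add: inner_diff_left field_simps)
  qed
  then show ?thesis by blast
qed (auto intro: exI[of _ 0])

context
  fixes T :: "'a::{real_inner,banach} \<Rightarrow> 'b::real_inner"
  assumes T: "bounded_linear T"
begin

text \<open>\<open>adjoint\<close> selects by choice a map with this property, so existence
  suffices; it comes from representing \<open>x \<mapsto> T x \<bullet> y\<close> for each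
  \<open>y\<close>.\<close>

lemma adjoint_works_bounded: "x \<bullet> adjoint T y = T x \<bullet> y"
proof -
  have "\<forall>y. \<exists>w. \<forall>x. T x \<bullet> y = x \<bullet> w"
    by (intro allI riesz_representation bounded_linear_compose[OF _ T, unfolded o_def]
        bounded_linear_inner_left)
  then have "\<exists>g. \<forall>x y. T x \<bullet> y = x \<bullet> g y" by metis
  then have "\<forall>x y. T x \<bullet> y = x \<bullet> adjoint T y"
    unfolding adjoint_def by (rule someI_ex)
  then show ?thesis by simp
qed

lemma bounded_linear_adjoint: "bounded_linear (adjoint T)"
proof -
  obtain K where K: "\<And>x. norm (T x) \<le> norm x * K" "K > 0"
    using bounded_linear.pos_bounded[OF T] by blast
  have ext: "u = v" if "\<And>x. x \<bullet> u = x \<bullet> v" for u v :: 'a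
    using that[of "u - v"] by (metis inner_diff_right inner_eq_zero_iff right_minus_eq)
  show ?thesis
  proof (rule bounded_linear_intro[where K=K])
    fix x y r
    show "adjoint T (x + y) = adjoint T x + adjoint T y"
      by (rule ext) (simp add: adjoint_works_bounded inner_add_right)
    show "adjoint T (r *\<^sub>R x) = r *\<^sub>R adjoint T x"
      by (rule ext) (simp add: adjoint_works_bounded)
    have "norm (adjoint T x) * norm (adjoint T x) = T (adjoint T x) \<bullet> x"
      by (metis adjoint_works_bounded power2_eq_square power2_norm_eq_inner)
    also have "\<dots> \<le> norm (adjoint T x) * K * norm x"
      using K(1) norm_cauchy_schwarz by (meson mult_right_mono norm_ge_zero order_trans)
    finally show "norm (adjoint T x) \<le> norm x * K"
      using K(2) by (cases "adjoint T x = 0") (auto simp: mult_ac)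
  qed
qed

end

text \<open>Testing \<open>x\<close> against \<open>adjoint T (T x)\<close> gives the squared norm
  of \<open>T x\<close>.\<close>

lemma orthogonal_comp_range_adjoint:
  fixes T :: "'a::{real_inner,banach} \<Rightarrow> 'b::real_inner"
  assumes T: "bounded_linear T"
  shows "(range (adjoint T))\<^sup>\<bottom> = {x. T x = 0}"
proof (intro set_eqI iffI)
  fix x assume "x \<in> (range (adjoint T))\<^sup>\<bottom>"
  then have "x \<bullet> adjoint T (T x) = 0" by (blast dest: orthogonal_compD)
  then show "x \<in> {x. T x = 0}" by (simp add: adjoint_works_bounded[OF T])
qed (auto intro!: orthogonal_compI simp: adjoint_works_bounded[OF T] inner_commute)

lemma orthogonal_comp_range:
  fixes T :: "'a::{real_inner,banach} \<Rightarrow> 'b::real_inner"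
  assumes T: "bounded_linear T"
  shows "(range T)\<^sup>\<bottom> = {y. adjoint T y = 0}"
proof (intro set_eqI iffI)
  fix y assume "y \<in> (range T)\<^sup>\<bottom>"
  then have "T (adjoint T y) \<bullet> y = 0" by (blast dest: orthogonal_compD)
  then show "y \<in> {y. adjoint T y = 0}" by (simp flip: adjoint_works_bounded[OF T])
qed (auto intro!: orthogonal_compI simp flip: adjoint_works_bounded[OF T])

section \<open>Square roots of positive operators by a norm-convergent iteration\<close>

text \<open>If \<open>Y = (B + Y\<^sup>2) / 2\<close> then \<open>(1 - Y)\<^sup>2 = 1 - B\<close>.  The iteration for the scalar \<open>B = 1\<close>
  dominates the increments of the operator iteration, which therefore converges in norm.\<close>

primrec sqrt_seq :: "('a::real_normed_vector \<Rightarrow>\<^sub>L 'a) \<Rightarrow> nat \<Rightarrow> 'a \<Rightarrow>\<^sub>L 'a" where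
  "sqrt_seq B 0 = 0"
| "sqrt_seq B (Suc n) = (1/2) *\<^sub>R (B + (sqrt_seq B n o\<^sub>L sqrt_seq B n))"

primrec sqrt_majorant :: "nat \<Rightarrow> real" where
  "sqrt_majorant 0 = 0"
| "sqrt_majorant (Suc n) = (1 + (sqrt_majorant n)\<^sup>2) / 2"

lemma sqrt_majorant_bounds: "0 \<le> sqrt_majorant n" "sqrt_majorant n \<le> 1"
  by (induction n) (auto simp: power_le_one)

lemma sqrt_majorant_Suc_ge: "sqrt_majorant n \<le> sqrt_majorant (Suc n)"
  using zero_le_power2[of "sqrt_majorant n - 1"] by (simp add: power2_eq_square algebra_simps)

lemma norm_sqrt_seq_le:
  assumes "norm B \<le> 1"
  shows "norm (sqrt_seq B n) \<le> sqrt_majorant n"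
proof (induction n)
  case (Suc n)
  have "norm (sqrt_seq B (Suc n)) \<le> (norm B + norm (sqrt_seq B n o\<^sub>L sqrt_seq B n)) / 2"
    using norm_triangle_ineq[of B "sqrt_seq B n o\<^sub>L sqrt_seq B n"] by simp
  moreover have "norm (sqrt_seq B n o\<^sub>L sqrt_seq B n) \<le> (sqrt_majorant n)\<^sup>2"
    using norm_blinfun_compose[of "sqrt_seq B n" "sqrt_seq B n"]
      mult_mono'[OF Suc Suc norm_ge_zero norm_ge_zero]
    by (simp add: power2_eq_square)
  ultimately show ?case using assms by simp
qed simp

lemma norm_sqrt_seq_diff_le:
  assumes "norm B \<le> 1"
  shows "norm (sqrt_seq B (Suc n) - sqrt_seq B n) \<le> sqrt_majorant (Suc n) - sqrt_majorant n"
proof (induction n)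
  case 0
  then show ?case using assms by simp
next
  case (Suc n)
  let ?Y = "sqrt_seq B" and ?q = sqrt_majorant
  let ?D = "?Y (Suc n) - ?Y n"
  \<comment> \<open>The difference of two squares is factored without commuting the factors; the
    scalar majorant satisfies the same recursion.\<close>
  have "?Y (Suc (Suc n)) - ?Y (Suc n) = (1/2) *\<^sub>R ((?Y (Suc n) o\<^sub>L ?D) + (?D o\<^sub>L ?Y n))"
  proof -
    have "?Y (Suc (Suc n)) - ?Y (Suc n)
        = (1/2) *\<^sub>R ((?Y (Suc n) o\<^sub>L ?Y (Suc n)) - (?Y n o\<^sub>L ?Y n))"
      by (simp only: sqrt_seq.simps(2)[of B "Suc n"] sqrt_seq.simps(2)[of B n]
          scaleR_diff_right[symmetric] add_diff_cancel_left)
    also have "(?Y (Suc n) o\<^sub>L ?Y (Suc n)) - (?Y n o\<^sub>L ?Y n) = (?Y (Suc n) o\<^sub>L ?D) + (?D o\<^sub>L ?Y n)"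
      by (simp only: bounded_bilinear.diff_left[OF bounded_bilinear_blinfun_compose]
          bounded_bilinear.diff_right[OF bounded_bilinear_blinfun_compose] diff_add_cancel
          add_diff_eq)
    finally show ?thesis .
  qed
  then have "norm (?Y (Suc (Suc n)) - ?Y (Suc n))
      \<le> (norm (?Y (Suc n) o\<^sub>L ?D) + norm (?D o\<^sub>L ?Y n)) / 2"
    using norm_triangle_ineq[of "?Y (Suc n) o\<^sub>L ?D" "?D o\<^sub>L ?Y n"] by (simp del: sqrt_seq.simps)
  also have "norm (?Y (Suc n) o\<^sub>L ?D) \<le> ?q (Suc n) * (?q (Suc n) - ?q n)"
    by (rule order_trans[OF norm_blinfun_compose])
      (intro mult_mono' norm_sqrt_seq_le assms Suc norm_ge_zero)
  also have "norm (?D o\<^sub>L ?Y n) \<le> (?q (Suc n) - ?q n) * ?q n"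
    by (rule order_trans[OF norm_blinfun_compose])
      (intro mult_mono' norm_sqrt_seq_le assms Suc norm_ge_zero)
  also have "(?q (Suc n) * (?q (Suc n) - ?q n) + (?q (Suc n) - ?q n) * ?q n) / 2
      = ?q (Suc (Suc n)) - ?q (Suc n)"
    by (simp only: sqrt_majorant.simps(2)[of "Suc n"] sqrt_majorant.simps(2)[of n])
      (simp add: power2_eq_square field_simps)
  finally show ?case by simp
qed

lemma convergent_sqrt_seq:
  fixes B :: "'a::banach \<Rightarrow>\<^sub>L 'a"
  assumes B: "norm B \<le> 1"
  shows "convergent (sqrt_seq B)"
proof -
  have "convergent sqrt_majorant"
    using sqrt_majorant_bounds sqrt_majorant_Suc_ge
    by (intro Bseq_monoseq_convergent BseqI'[where K=1] monoI1 mono_SucI1 incseq_SucI)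
      (auto simp: monoseq_Suc)
  \<comment> \<open>The increments of the majorant telescope, so their series converges because the
    bounded monotone majorant does.\<close>
  then have "summable (\<lambda>n. sqrt_majorant (Suc n) - sqrt_majorant n)"
    unfolding convergent_def using telescope_summable by blast
  then have "summable (\<lambda>n. sqrt_seq B (Suc n) - sqrt_seq B n)"
    by (rule summable_comparison_test'[where N=0]) (rule norm_sqrt_seq_diff_le[OF B])
  then have "convergent (\<lambda>n. \<Sum>i<n. sqrt_seq B (Suc i) - sqrt_seq B i)"
    by (simp add: summable_iff_convergent)
  then show ?thesis by (simp only: sum_lessThan_telescope) simp
qed

text \<open>With \<open>B = 1 - Z\<close>, the limit \<open>Y\<close> of the iteration satisfies the
  fixed point equation, so \<open>X = 1 - Y\<close> squares to \<open>Z\<close>. Symmetry and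
  commutation pass from the iterates to the limit, and \<open>norm Y \<le> 1\<close> makes
  \<open>X\<close> positive.\<close>

lemma positive_sqrt_contraction:
  fixes Z :: "'a::{real_inner,banach} \<Rightarrow> 'a"
  assumes Z: "bounded_linear Z" and sym: "\<And>x y. Z x \<bullet> y = x \<bullet> Z y"
    and contr: "\<And>x. norm (x - Z x) \<le> norm x"
  obtains X where "bounded_linear X" "\<And>x y. X x \<bullet> y = x \<bullet> X y" "\<And>x. 0 \<le> X x \<bullet> x"
    "\<And>x. X (X x) = Z x"
    "\<And>J x. bounded_linear J \<Longrightarrow> (\<And>x. J (Z x) = Z (J x)) \<Longrightarrow> J (X x) = X (J x)"
proof -
  define B where "B = Blinfun (\<lambda>x. x - Z x)"
  have B: "blinfun_apply B x = x - Z x" for x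
    unfolding B_def by (simp add: bounded_linear_Blinfun_apply bounded_linear_sub Z)
  have nB: "norm B \<le> 1"
    by (rule norm_blinfun_bound) (simp_all add: B contr)
  obtain Y where Y: "sqrt_seq B \<longlonglongrightarrow> Y"
    using convergent_sqrt_seq[OF nB] by (auto simp: convergent_def)
  have Yx: "(\<lambda>n. sqrt_seq B n x) \<longlonglongrightarrow> Y x" for x
    by (intro tendsto_intros Y)
  have "Y = (1/2) *\<^sub>R (B + (Y o\<^sub>L Y))"
  proof (rule LIMSEQ_unique)
    show "(\<lambda>n. sqrt_seq B (Suc n)) \<longlonglongrightarrow> Y"
      using Y by (rule LIMSEQ_Suc)
    show "(\<lambda>n. sqrt_seq B (Suc n)) \<longlonglongrightarrow> (1/2) *\<^sub>R (B + (Y o\<^sub>L Y))"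
      unfolding sqrt_seq.simps
      by (intro tendsto_intros Y bounded_bilinear.tendsto[OF bounded_bilinear_blinfun_compose])
  qed
  then have "2 *\<^sub>R Y = B + (Y o\<^sub>L Y)"
    by (metis scaleR_2 scaleR_half_double scaleR_add_right)
  then have Y_eq: "2 *\<^sub>R Y x = (x - Z x) + Y (Y x)" for x
    by (metis B blinfun.add_left blinfun.scaleR_left blinfun_apply_blinfun_compose)
  have "norm Y \<le> 1"
    using Lim_bounded[OF tendsto_norm[OF Y], of 0 1] norm_sqrt_seq_le[OF nB] sqrt_majorant_bounds(2)
    by (meson order_trans)
  then have nY: "norm (Y x) \<le> norm x" for x
    using norm_blinfun[of Y x] mult_right_mono[of "norm Y" 1 "norm x"] by simp
  have symn: "sqrt_seq B n x \<bullet> y = x \<bullet> sqrt_seq B n y" for n x y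
    by (induction n arbitrary: x y)
      (simp_all add: blinfun.bilinear_simps B inner_diff_left inner_diff_right
        inner_add_left inner_add_right sym)
  have symY: "Y x \<bullet> y = x \<bullet> Y y" for x y
  proof (rule LIMSEQ_unique)
    show "(\<lambda>n. sqrt_seq B n x \<bullet> y) \<longlonglongrightarrow> Y x \<bullet> y" by (intro tendsto_intros Yx)
    show "(\<lambda>n. sqrt_seq B n x \<bullet> y) \<longlonglongrightarrow> x \<bullet> Y y"
      unfolding symn by (intro tendsto_intros Yx)
  qed
  have commY: "J (Y x) = Y (J x)"
    if J: "bounded_linear J" "\<And>x. J (Z x) = Z (J x)" for J x
  proof -
    interpret J: bounded_linear J by fact
    have "J (sqrt_seq B n x) = sqrt_seq B n (J x)" for n x
      by (induction n arbitrary: x)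
        (simp_all add: blinfun.bilinear_simps B J.diff J.add J.scale J.zero J(2))
    then have "(\<lambda>n. J (sqrt_seq B n x)) \<longlonglongrightarrow> Y (J x)" using Yx by simp
    moreover have "(\<lambda>n. J (sqrt_seq B n x)) \<longlonglongrightarrow> J (Y x)" by (intro J.tendsto Yx)
    ultimately show ?thesis by (rule LIMSEQ_unique[rotated])
  qed
  define X where "X x = x - Y x" for x
  have X1: "bounded_linear X"
    unfolding X_def by (intro bounded_linear_sub bounded_linear_ident blinfun.bounded_linear_right)
  have X2: "X x \<bullet> y = x \<bullet> X y" for x y
    by (simp add: X_def inner_diff_left inner_diff_right symY)
  have X3: "0 \<le> X x \<bullet> x" for x
    using norm_cauchy_schwarz[of "Y x" x] mult_right_mono[OF nY[of x], of "norm x"]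
    by (simp add: X_def inner_diff_left power2_norm_eq_inner[symmetric] power2_eq_square)
  have X4: "X (X x) = Z x" for x
    using Y_eq[of x] by (simp add: X_def blinfun.bilinear_simps scaleR_2 algebra_simps)
  have X5: "J (X x) = X (J x)"
    if "bounded_linear J" "\<And>x. J (Z x) = Z (J x)" for J x
    using commY[OF that] that(1) by (simp add: X_def linear_diff bounded_linear.linear)
  show thesis by (rule that[OF X1 X2 X3 X4 X5])
qed

text \<open>Dividing \<open>T\<close> composed with its adjoint by \<open>c\<^sup>2\<close>, where
  \<open>c\<close> bounds \<open>T\<close>, reduces to the contraction case; the root is then
  multiplied by \<open>c\<close>.\<close>

lemma positive_sqrt_compose_adjoint:
  fixes T :: "'a::{real_inner,banach} \<Rightarrow> 'b::{real_inner,banach}"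
  assumes T: "bounded_linear T"
  obtains X where "bounded_linear X" "\<And>x y. X x \<bullet> y = x \<bullet> X y" "\<And>x. 0 \<le> X x \<bullet> x"
    "\<And>x. X (X x) = T (adjoint T x)"
    "\<And>J x. bounded_linear J \<Longrightarrow> (\<And>x. J (T (adjoint T x)) = T (adjoint T (J x))) \<Longrightarrow>
      J (X x) = X (J x)"
proof -
  interpret T: bounded_linear T by fact
  obtain c where c: "\<And>x. norm (T x) \<le> norm x * c" "c > 0"
    using T.pos_bounded by blast
  define Z where "Z x = (1 / c\<^sup>2) *\<^sub>R T (adjoint T x)" for x
  have adj: "T x \<bullet> y = x \<bullet> adjoint T y" "y \<bullet> T x = adjoint T y \<bullet> x" for x y
    using adjoint_works_bounded[OF T] by (simp_all add: inner_commute)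
  have blZ: "bounded_linear Z"
    unfolding Z_def by (intro bounded_linear_scaleR_const bounded_linear_const_scaleR
        bounded_linear_compose[OF T] bounded_linear_adjoint T)
  have symZ: "Z x \<bullet> y = x \<bullet> Z y" for x y
    by (simp add: Z_def adj)
  \<comment> \<open>The bound \<open>c\<close> gives that the squared norm of \<open>Z x\<close> is
    at most \<open>Z x \<bullet> x\<close>, so expanding the squared norm of \<open>x - Z x\<close>
    yields at most that of \<open>x\<close>.\<close>
  have contr: "norm (x - Z x) \<le> norm x" for x
  proof (rule power2_le_imp_le)
    have "(norm (Z x))\<^sup>2 = (norm (T (adjoint T x)))\<^sup>2 / (c\<^sup>2)\<^sup>2"
      by (simp add: Z_def power_divide)
    also have "\<dots> \<le> (norm (adjoint T x) * c)\<^sup>2 / (c\<^sup>2)\<^sup>2"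
      by (intro divide_right_mono power_mono c) auto
    also have "\<dots> = Z x \<bullet> x"
      using c(2) by (simp add: Z_def adj dot_square_norm power_mult_distrib field_simps)
    finally have "(norm (Z x))\<^sup>2 \<le> Z x \<bullet> x" .
    moreover from this have "0 \<le> Z x \<bullet> x" using zero_le_power2 order_trans by blast
    ultimately have "(norm (Z x))\<^sup>2 \<le> 2 * (Z x \<bullet> x)" by simp
    moreover have "(norm (x - Z x))\<^sup>2 = (norm x)\<^sup>2 - 2 * (Z x \<bullet> x) + (norm (Z x))\<^sup>2"
      by (simp add: power2_norm_eq_inner inner_commute algebra_simps)
    ultimately show "(norm (x - Z x))\<^sup>2 \<le> (norm x)\<^sup>2" by simp
  qed simp
  obtain W where W: "bounded_linear W" "\<And>x y. W x \<bullet> y = x \<bullet> W y" "\<And>x. 0 \<le> W x \<bullet> x"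
    "\<And>x. W (W x) = Z x"
    "\<And>J x. bounded_linear J \<Longrightarrow> (\<And>x. J (Z x) = Z (J x)) \<Longrightarrow> J (W x) = W (J x)"
    using positive_sqrt_contraction[OF blZ symZ contr] by blast
  interpret W: bounded_linear W by fact
  define X where "X x = c *\<^sub>R W x" for x
  have X1: "bounded_linear X"
    unfolding X_def by (intro bounded_linear_const_scaleR W)
  have X2: "X x \<bullet> y = x \<bullet> X y" "0 \<le> X x \<bullet> x" "X (X x) = T (adjoint T x)" for x y
    using c(2) W(2,3,4) by (simp_all add: X_def W.scale Z_def power2_eq_square)
  have X3: "J (X x) = X (J x)"
    if J: "bounded_linear J" "\<And>x. J (T (adjoint T x)) = T (adjoint T (J x))" for J x
    using W(5)[OF J(1)] J by (simp add: X_def Z_def linear_scale bounded_linear.linear)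
  show thesis by (rule that[OF X1 X2 X3])
qed

section \<open>Polar decomposition\<close>

lemma closure_range_transfer:
  fixes F :: "'a::ab_group_add \<Rightarrow> 'b::real_normed_vector" and G :: "'a \<Rightarrow> 'c::banach"
    and P :: "'b \<Rightarrow> 'd::real_normed_vector"
  assumes F: "\<And>x y. F (x - y) = F x - F y" and G: "\<And>x y. G (x - y) = G x - G y"
    and norm_eq: "\<And>y. norm (F y) = norm (G y)"
    and P: "bounded_linear P" and Q: "bounded_linear Q"
    and PQ: "\<And>y. P (F y) = Q (G y)" and k: "k \<in> closure (range F)"
  shows "\<exists>l\<in>closure (range G). Q l = P k \<and> norm l = norm k"
proof -
  from k obtain f where "\<forall>n. f n \<in> range F" and f: "f \<longlonglongrightarrow> k"
    unfolding closure_sequential by blast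
  then have "\<forall>n. \<exists>y. f n = F y" by blast
  then obtain y where y: "\<And>n. f n = F (y n)" by metis
  \<comment> \<open>Equal norms make \<open>G (y n)\<close> Cauchy together with
    \<open>F (y n)\<close>; this extends the isometric correspondence between the ranges to their
    closures.\<close>
  have "Cauchy f" using f by (blast intro: LIMSEQ_imp_Cauchy)
  moreover have "dist (G (y m)) (G (y n)) = dist (f m) (f n)" for m n
    by (simp add: dist_norm y F[symmetric] G[symmetric] norm_eq)
  ultimately have "Cauchy (\<lambda>n. G (y n))" by (simp add: Cauchy_def)
  then obtain l where l: "(\<lambda>n. G (y n)) \<longlonglongrightarrow> l"
    using Cauchy_convergent unfolding convergent_def by blast
  have "l \<in> closure (range G)"
    unfolding closure_sequential using l by (intro exI[of _ "\<lambda>n. G (y n)"]) simp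
  moreover have "norm l = norm k"
    by (rule LIMSEQ_unique[OF tendsto_norm[OF l]]) (use tendsto_norm[OF f] in \<open>simp add: y norm_eq\<close>)
  moreover have "Q l = P k"
    by (rule LIMSEQ_unique[OF bounded_linear.tendsto[OF Q l]])
      (use bounded_linear.tendsto[OF P f] in \<open>simp add: y PQ\<close>)
  ultimately show ?thesis by blast
qed

text \<open>\<open>X\<close> is the root of \<open>T\<close> composed with its adjoint, so
  \<open>X y\<close> and \<open>adjoint T y\<close> have equal norms. The isometry \<open>U\<close>
  sends \<open>adjoint T y\<close> to \<open>X y\<close> and extends to closures. The commutation
  clause later yields complex linearity of \<open>X\<close>.\<close>

lemma polar_decomposition:
  fixes T :: "'a::{real_inner,banach} \<Rightarrow> 'b::{real_inner,banach}"
  assumes T: "bounded_linear T"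
  obtains X U where
    "bounded_linear X" "\<And>x y. X x \<bullet> y = x \<bullet> X y" "\<And>x. 0 \<le> X x \<bullet> x"
    "\<And>J x. bounded_linear J \<Longrightarrow> (\<And>x. J (T (adjoint T x)) = T (adjoint T (J x))) \<Longrightarrow> J (X x) = X (J x)"
    "closure (range X) = closure (range T)"
    "inj_on X (closure (range T))" "X ` closure (range T) = range X"
    "U ` ({x. T x = 0}\<^sup>\<bottom>) = closure (range T)"
    "\<And>l. l \<in> {x. T x = 0}\<^sup>\<bottom> \<Longrightarrow> X (U l) = T l"
    "\<And>l l'. l \<in> {x. T x = 0}\<^sup>\<bottom> \<Longrightarrow> l' \<in> {x. T x = 0}\<^sup>\<bottom> \<Longrightarrow> U l \<bullet> U l' = l \<bullet> l'"
proof -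
  interpret T: bounded_linear T by fact
  interpret T': bounded_linear "adjoint T" by (rule bounded_linear_adjoint[OF T])
  obtain X where X: "bounded_linear X" "\<And>x y. X x \<bullet> y = x \<bullet> X y" "\<And>x. 0 \<le> X x \<bullet> x"
    "\<And>x. X (X x) = T (adjoint T x)"
    "\<And>J x. bounded_linear J \<Longrightarrow> (\<And>x. J (T (adjoint T x)) = T (adjoint T (J x))) \<Longrightarrow> J (X x) = X (J x)"
    using positive_sqrt_compose_adjoint[OF T] by blast
  interpret X: bounded_linear X by fact
  have subspace_range: "subspace (range f)" if "linear f" for f :: "'c::real_vector \<Rightarrow> 'd::real_vector"
    using linear_subspace_image[OF that subspace_UNIV] .
  define K where "K = closure (range T)"
  define L where "L = {x. T x = 0}\<^sup>\<bottom>"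
  have norm_X: "norm (X y) = norm (adjoint T y)" for y
    by (simp add: norm_eq_sqrt_inner X(2,4) adjoint_works_bounded[OF T] inner_commute)
  have K_perp: "K\<^sup>\<bottom> = {y. X y = 0}"
    unfolding K_def orthogonal_comp_closure orthogonal_comp_range[OF T]
    by (metis norm_X norm_eq_zero)
  have adj_X: "adjoint X = X"
    by (rule adjoint_unique) (simp add: X(2))
  \<comment> \<open>The two ranges have the same orthogonal complement, hence the same double
    complement, which is the closure.\<close>
  have K_X: "closure (range X) = K"
    unfolding K_def
    using orthogonal_comp_orthogonal_comp_closure[OF subspace_range, OF X.linear]
      orthogonal_comp_orthogonal_comp_closure[OF subspace_range, OF T.linear]
      K_perp orthogonal_comp_range[OF X(1)]
    by (simp add: K_def orthogonal_comp_closure adj_X)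
  have L_closure: "L = closure (range (adjoint T))"
    using orthogonal_comp_orthogonal_comp_closure[OF subspace_range, OF T'.linear]
    by (simp add: L_def orthogonal_comp_range_adjoint[OF T])
  have sK: "subspace K" "closed K" and sL: "subspace L"
    unfolding K_def L_def
    by (simp_all add: subspace_closure subspace_range T.linear subspace_orthogonal_comp)
  have X_T: "\<exists>l\<in>L. T l = X k \<and> norm l = norm k" if "k \<in> K" for k
    unfolding L_closure
    using closure_range_transfer[of X "adjoint T" X T k] that
    by (simp add: X.diff T'.diff norm_X X T K_X)
  have T_X: "\<exists>k\<in>K. X k = T l \<and> norm k = norm l" if "l \<in> L" for l
    using closure_range_transfer[of "adjoint T" X T X l] that
    by (simp add: X.diff T'.diff norm_X X T K_X L_closure)
  have X_inj: "k = 0" if "k \<in> K" "X k = 0" for k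
  proof -
    have "k \<bullet> k = 0" using that K_perp by (blast dest: orthogonal_compD)
    then show ?thesis by simp
  qed
  have X_injD: "k = k'" if "k \<in> K" "k' \<in> K" "X k = X k'" for k k'
    using X_inj[of "k - k'"] that sK(1) by (simp add: subspace_diff X.diff)
  \<comment> \<open>Linearity of \<open>U\<close> is not built into the choice; it follows because
    \<open>X\<close> is injective on \<open>K\<close>.\<close>
  obtain U where U: "\<And>l. l \<in> L \<Longrightarrow> U l \<in> K" "\<And>l. l \<in> L \<Longrightarrow> X (U l) = T l"
    "\<And>l. l \<in> L \<Longrightarrow> norm (U l) = norm l"
    using T_X by metis
  have U_add: "U (l + l') = U l + U l'" if "l \<in> L" "l' \<in> L" for l l'
    using that sK(1) sL
    by (intro X_injD[of "U (l + l')"]) (simp_all add: U subspace_add X.add T.add)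
  \<comment> \<open>Polarization recovers the inner product from additivity and preservation of
    norms.\<close>
  have U_inner: "U l \<bullet> U l' = l \<bullet> l'" if "l \<in> L" "l' \<in> L" for l l'
    using that U(3)[of "l + l'"] sL by (simp add: dot_norm U_add U(3) subspace_add)
  have T_inj: "l = 0" if "l \<in> L" "T l = 0" for l
  proof -
    have "l \<bullet> l = 0" using that unfolding L_def by (blast dest: orthogonal_compD)
    then show ?thesis by simp
  qed
  have UL: "U ` L = K"
  proof (intro antisym subsetI)
    fix k assume k: "k \<in> K"
    then obtain l where l: "l \<in> L" "T l = X k" using X_T by blast
    then have "U l = k" using X_injD[of "U l" k] k U by simp
    then show "k \<in> U ` L" using l(1) by blast
  qed (use U(1) in blast)
  have inj: "inj_on X K" using X_injD by (auto intro: inj_onI)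
  have XK: "X ` K = range X"
  proof (intro antisym subsetI)
    fix z assume "z \<in> range X"
    then obtain y where y: "z = X y" by blast
    \<comment> \<open>The component of \<open>y\<close> orthogonal to \<open>K\<close> is
      annihilated by \<open>X\<close>.\<close>
    have "y - orth_proj K y \<in> K\<^sup>\<bottom>" by (rule orth_proj_diff[OF sK])
    then have "z = X (orth_proj K y)" using y K_perp by (simp add: X.diff)
    then show "z \<in> X ` K" using orth_proj_in[OF sK] by blast
  qed blast
  show thesis
    by (rule that[of X U, folded K_def L_def])
      (fact X(1) X(2) X(3) X(5) K_X inj XK UL U(2) U_inner)+
qed

section \<open>Complex structure expressed through the real inner product\<close>

lemma inner_scaleC_left: "(c *\<^sub>C x) \<bullet> y = x \<bullet> (cnj c *\<^sub>C y)"
  for x y :: "'a::complex_inner"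
proof -
  have "cinner x (cnj c *\<^sub>C y) = c * cinner x y"
    by (metis cinner_commute cinner_scaleC_left complex_cnj_cnj complex_cnj_mult)
  then show ?thesis
    by (simp add: cinner_scaleC_left flip: Re_cinner)
qed

lemma inner_scaleC_right: "x \<bullet> (c *\<^sub>C y) = (cnj c *\<^sub>C x) \<bullet> y"
  for x y :: "'a::complex_inner"
  by (simp add: inner_scaleC_left)

lemma Im_cinner: "Im (cinner x y) = x \<bullet> (\<i> *\<^sub>C y)"
  for x y :: "'a::complex_inner"
proof -
  have "x \<bullet> (\<i> *\<^sub>C y) = Re (cinner (cnj \<i> *\<^sub>C x) y)"
    by (simp only: inner_scaleC_right Re_cinner)
  then show ?thesis unfolding cinner_scaleC_left by simp
qed

lemma bounded_linear_scaleC: "bounded_linear (\<lambda>x :: 'a::complex_inner. c *\<^sub>C x)"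
proof (rule bounded_linear_intro[where K="cmod c"])
  fix x y :: 'a and r
  show "c *\<^sub>C (x + y) = c *\<^sub>C x + c *\<^sub>C y" by (rule scaleC_add_right)
  show "c *\<^sub>C (r *\<^sub>R x) = r *\<^sub>R (c *\<^sub>C x)"
    by (simp add: scaleR_scaleC scaleC_scaleC mult.commute)
  have "cnj c * c = complex_of_real ((cmod c)\<^sup>2)"
    by (metis complex_norm_square mult.commute)
  then have "(c *\<^sub>C x) \<bullet> (c *\<^sub>C x) = x \<bullet> ((cmod c)\<^sup>2 *\<^sub>R x)"
    by (simp only: inner_scaleC_left scaleC_scaleC scaleR_scaleC)
  then have "(norm (c *\<^sub>C x))\<^sup>2 = (norm x * cmod c)\<^sup>2"
    by (simp add: power2_norm_eq_inner power_mult_distrib)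
  then show "norm (c *\<^sub>C x) \<le> norm x * cmod c" by simp
qed

lemma csubspace_imp_subspace: "csubspace V \<Longrightarrow> subspace V"
  by (simp add: complex_vector.subspace_def subspace_def scaleR_scaleC)

lemma csubspace_orthogonal_comp:
  fixes V :: "'a::complex_inner set"
  assumes "csubspace V"
  shows "csubspace (V\<^sup>\<bottom>)"
  unfolding complex_vector.subspace_def
proof (intro conjI ballI allI)
  fix c x assume x: "x \<in> V\<^sup>\<bottom>"
  show "c *\<^sub>C x \<in> V\<^sup>\<bottom>"
  proof (rule orthogonal_compI)
    fix y assume "y \<in> V"
    then have "cnj c *\<^sub>C y \<in> V" using assms by (simp add: complex_vector.subspace_scale)
    then show "y \<bullet> (c *\<^sub>C x) = 0"
      unfolding inner_scaleC_right using x by (blast dest: orthogonal_compD)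
  qed
qed (auto intro: subspace_0 subspace_add subspace_orthogonal_comp)

text \<open>A complex subspace contains \<open>\<i> *\<^sub>C y\<close> along with \<open>y\<close>;
  real orthogonality to these two kills the real and the imaginary part.\<close>

lemma cinner_eq_0_if_orthogonal_comp:
  fixes V :: "'a::complex_inner set"
  assumes "csubspace V" "x \<in> V\<^sup>\<bottom>" "y \<in> V"
  shows "cinner x y = 0"
  using assms orthogonal_compD(1)[of x V y] orthogonal_compD(1)[of x V "\<i> *\<^sub>C y"]
  by (simp add: complex_eq_iff Im_cinner Re_cinner complex_vector.subspace_scale)

text \<open>Moving \<open>\<i>\<close> through the symmetric map \<open>X\<close> shows that the
  imaginary part of \<open>cinner (X x) x\<close> equals its own negative.\<close>

lemma positive_onI:
  fixes X :: "'a::complex_inner \<Rightarrow> 'a"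
  assumes "\<And>x y. X x \<bullet> y = x \<bullet> X y" "\<And>x. 0 \<le> X x \<bullet> x" "\<And>c x. X (c *\<^sub>C x) = c *\<^sub>C X x"
  shows "positive_on K X"
proof -
  have "Im (cinner (X x) x) = 0" for x
  proof -
    have "Im (cinner (X x) x) = (cnj \<i> *\<^sub>C X x) \<bullet> x" by (simp add: Im_cinner inner_scaleC_right)
    also have "\<dots> = (cnj \<i> *\<^sub>C x) \<bullet> X x" by (simp only: assms flip: assms(3))
    also have "\<dots> = - ((\<i> *\<^sub>C x) \<bullet> X x)" by simp
    also have "(\<i> *\<^sub>C x) \<bullet> X x = Im (cinner (X x) x)" by (simp add: Im_cinner inner_commute)
    finally show ?thesis by simp
  qed
  then show ?thesis
    using assms(2) by (simp add: positive_on_def Re_cinner complex_is_Real_iff)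
qed

lemma bounded_operator_onI:
  assumes "bounded_linear X" "\<And>c x. X (c *\<^sub>C x) = c *\<^sub>C X x" "X ` K \<subseteq> K"
  shows "bounded_operator_on K X"
  using assms bounded_linear.bounded[OF assms(1)]
  by (auto simp: bounded_operator_on_def linear_add bounded_linear.linear mult.commute)

lemma bounded_operator_on_UNIV_D:
  assumes "bounded_operator_on UNIV A"
  shows "bounded_linear A" "A (c *\<^sub>C x) = c *\<^sub>C A x"
proof -
  obtain B where B: "\<forall>x. norm (A x) \<le> B * norm x"
    using assms by (auto simp: bounded_operator_on_def)
  show "bounded_linear A"
    using assms B
    by (intro bounded_linear_intro[where K=B])
      (auto simp: bounded_operator_on_def scaleR_scaleC mult.commute)
qed (use assms in \<open>simp add: bounded_operator_on_def\<close>)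

lemma adjoint_scaleC:
  fixes T :: "'a::complex_hilbert_space \<Rightarrow> 'b::complex_inner"
  assumes "bounded_linear T" "\<And>c x. T (c *\<^sub>C x) = c *\<^sub>C T x"
  shows "adjoint T (c *\<^sub>C y) = c *\<^sub>C adjoint T y"
proof -
  have "x \<bullet> adjoint T (c *\<^sub>C y) = x \<bullet> (c *\<^sub>C adjoint T y)" for x
  proof -
    have "x \<bullet> adjoint T (c *\<^sub>C y) = (cnj c *\<^sub>C T x) \<bullet> y"
      by (simp only: adjoint_works_bounded[OF assms(1)] inner_scaleC_right)
    also have "\<dots> = T (cnj c *\<^sub>C x) \<bullet> y" by (simp only: assms(2))
    also have "\<dots> = x \<bullet> (c *\<^sub>C adjoint T y)"
      by (simp only: adjoint_works_bounded[OF assms(1)] inner_scaleC_right)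
    finally show ?thesis .
  qed
  then show ?thesis using vector_eq_ldot by blast
qed

lemma orth_proj_scaleC:
  fixes V :: "'a::complex_hilbert_space set"
  assumes "csubspace V" "closed V"
  shows "orth_proj V (c *\<^sub>C x) = c *\<^sub>C orth_proj V x"
  using assms csubspace_orthogonal_comp[OF assms(1)]
  by (intro orth_proj_commute)
    (auto simp: csubspace_imp_subspace bounded_linear.linear bounded_linear_scaleC
      complex_vector.subspace_scale)

lemma orth_proj_symmetric:
  fixes V :: "'a::{real_inner,banach} set"
  assumes V: "subspace V" "closed V"
  shows "orth_proj V x \<bullet> y = x \<bullet> orth_proj V y"
  using orthogonal_compD(2)[OF orth_proj_diff[OF V] orth_proj_in[OF V], of x y]
    orthogonal_compD(1)[OF orth_proj_diff[OF V] orth_proj_in[OF V], of x y]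
  by (simp add: inner_diff_left inner_diff_right)

lemma inter_orthogonal_comp_subset:
  "V \<inter> V\<^sup>\<bottom> \<subseteq> {0}"
proof
  fix x assume "x \<in> V \<inter> V\<^sup>\<bottom>"
  then have "x \<bullet> x = 0" by (blast dest: orthogonal_compD)
  then show "x \<in> {0}" by simp
qed

lemma csubspace_image:
  assumes "bounded_linear A" "\<And>c x. A (c *\<^sub>C x) = c *\<^sub>C A x" "csubspace V"
  shows "csubspace (A ` V)"
proof -
  interpret A: bounded_linear A by fact
  show ?thesis
    unfolding complex_vector.subspace_def
  proof (intro conjI ballI allI)
    show "0 \<in> A ` V"
      using complex_vector.subspace_0[OF assms(3)] A.zero by (metis imageI)
  next
    fix x y assume "x \<in> A ` V" "y \<in> A ` V"
    then show "x + y \<in> A ` V"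
      using complex_vector.subspace_add[OF assms(3)] by (auto simp flip: A.add)
  next
    fix c x assume "x \<in> A ` V"
    then show "c *\<^sub>C x \<in> A ` V"
      using complex_vector.subspace_scale[OF assms(3)] by (auto simp flip: assms(2))
  qed
qed

lemma csubspace_vimage:
  assumes "bounded_linear A" "\<And>c x. A (c *\<^sub>C x) = c *\<^sub>C A x" "csubspace V"
  shows "csubspace (A -` V)"
proof -
  interpret A: bounded_linear A by fact
  show ?thesis
    using assms(2,3) by (auto simp: complex_vector.subspace_def A.zero A.add)
qed

text \<open>Relative closedness suffices because the values of \<open>A\<close> stay in
  \<open>W\<close>: \<open>V\<close> may be replaced by a closed set of the whole space with the
  same preimage.\<close>

lemma closed_vimage_inter:
  assumes "bounded_linear A" "range A \<subseteq> W" "closedin (top_of_set W) V"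
  shows "closed (A -` V)"
proof -
  obtain C where C: "closed C" "V = W \<inter> C"
    using assms(3) by (auto simp: closedin_closed)
  then have "A -` V = A -` C" using assms(2) by auto
  then show ?thesis
    using C(1) by (simp add: closed_vimage linear_continuous_on[OF assms(1)])
qed

section \<open>Construction of \<open>X\<close>, \<open>P0\<close> and \<open>S\<close> from the two
  operator ranges\<close>

theorem corollary5p10:
  fixes M N K :: "'a::complex_hilbert_space set"
  assumes "separable_space (euclidean :: 'a topology)"
    and "operator_range M" and "operator_range N"
    and "closedin (top_of_set (M + N)) (M \<inter> N)"
    and K_def: "K = closure (M + N)"
  shows "\<exists>X P0 S.
    bounded_operator_on K X \<and> positive_on K X \<and> quasi_affinity_on K X \<and>
    bounded_operator_on K P0 \<and> positive_on K P0 \<and> idempotent_on K P0 \<and>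
    csubspace S \<and> closed S \<and> S \<subseteq> K \<and>
    corthogonal_sets (graph_on K P0) ({0} \<times> S) \<and>
    proj_rel M N \<bullet>\<^sub>r graph_on K X = graph_on K X \<bullet>\<^sub>r (graph_on K P0 + {0} \<times> S)"
proof -
  obtain A B where A0: "bounded_operator_on UNIV A" and M: "M = range A"
    and B0: "bounded_operator_on UNIV B" and N: "N = range B"
    using assms(2,3) unfolding operator_range_def by blast
  note A = bounded_operator_on_UNIV_D[OF A0] and B = bounded_operator_on_UNIV_D[OF B0]
  interpret A: bounded_linear A by (rule A)
  interpret B: bounded_linear B by (rule B)
  have csM: "csubspace M" and csN: "csubspace N"
    unfolding M N by (rule csubspace_image; rule A B complex_vector.subspace_UNIV)+
  note sM = csubspace_imp_subspace[OF csM] and sN = csubspace_imp_subspace[OF csN]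
  have MN: "M \<subseteq> M + N" "N \<subseteq> M + N"
    using subspace_0[OF sM] subspace_0[OF sN] by (force simp: set_plus_def)+
  have csMN: "csubspace (M \<inter> N)"
    by (rule complex_vector.subspace_inter[OF csM csN])

  define D where "D = B -` (M \<inter> N)"
  define E where "E = A -` (M \<inter> N)"
  have csD: "csubspace D" and csE: "csubspace E"
    unfolding D_def E_def by (rule csubspace_vimage; rule A B csMN)+
  \<comment> \<open>The relative closedness of \<open>M \<inter> N\<close> enters here, and again
    for \<open>S\<close>.\<close>
  have clD: "closed D" and clE: "closed E"
    unfolding D_def E_def
    by (rule closed_vimage_inter; use A B MN assms(4) in \<open>simp add: M N\<close>)+
  note sD = csubspace_imp_subspace[OF csD] and sE = csubspace_imp_subspace[OF csE]
  note csDp = csubspace_orthogonal_comp[OF csD]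
  note sDp = subspace_orthogonal_comp[of D]
  have D_iff: "v \<in> D \<longleftrightarrow> B v \<in> M" and E_iff: "u \<in> E \<longleftrightarrow> A u \<in> N" for u v
    by (auto simp: D_def E_def M N)
  define Ap where "Ap = {u. A u = 0}\<^sup>\<bottom>"
  have sAp: "subspace Ap" unfolding Ap_def by (rule subspace_orthogonal_comp)
  \<comment> \<open>This inclusion places the component of a vector orthogonal to \<open>E\<close>
    in \<open>Ap\<close>, the first factor of the space \<open>L\<close> below.\<close>
  have "{u. A u = 0} \<subseteq> E" using subspace_0[OF sN] by (auto simp: E_iff)
  then have E_Ap: "E\<^sup>\<bottom> \<subseteq> Ap" unfolding Ap_def by (rule orthogonal_comp_anti_mono)

  define Q where "Q = orth_proj (D\<^sup>\<bottom>)"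
  note Dp = subspace_orthogonal_comp[of D] closed_orthogonal_comp[of D]
  have Q_in: "Q v \<in> D\<^sup>\<bottom>" for v unfolding Q_def by (rule orth_proj_in[OF Dp])
  have Q_diff: "v - Q v \<in> D" for v
    using orth_proj_diff[OF Dp, of v] by (simp add: Q_def orthogonal_comp_orthogonal_comp sD clD)
  have Q_same: "v \<in> D\<^sup>\<bottom> \<Longrightarrow> Q v = v" for v unfolding Q_def by (rule orth_proj_same[OF Dp])
  define T where "T = (\<lambda>p. A (fst p) + B (Q (snd p)))"
  have T: "bounded_linear T"
    unfolding T_def Q_def
    by (intro bounded_linear_add bounded_linear_compose[OF A(1)] bounded_linear_compose[OF B(1)]
        bounded_linear_compose[OF bounded_linear_orth_proj[OF Dp]] bounded_linear_fst
        bounded_linear_snd)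
  have Tc: "T (c *\<^sub>C p) = c *\<^sub>C T p" for c p
    unfolding T_def Q_def
    by (simp add: scaleC_prod_def orth_proj_scaleC csDp closed_orthogonal_comp A B scaleC_add_right)

  \<comment> \<open>If \<open>T p = 0\<close> then \<open>B (Q (snd p))\<close> lies in
    \<open>M\<close>, so \<open>Q (snd p)\<close> lies in both \<open>D\<close> and its complement.
    The kernel is thus a product, and so is its complement \<open>L\<close>.\<close>
  have ker_T: "T p = 0 \<longleftrightarrow> A (fst p) = 0 \<and> snd p \<in> D" for p
  proof
    assume T0: "T p = 0"
    then have "B (Q (snd p)) = A (- fst p)"
      by (simp add: T_def A.neg add_eq_0_iff)
    then have "Q (snd p) \<in> D" by (simp add: D_iff M)
    then have "Q (snd p) = 0" using Q_in inter_orthogonal_comp_subset by blast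
    then show "A (fst p) = 0 \<and> snd p \<in> D"
      using T0 Q_diff[of "snd p"] by (simp add: T_def B.zero)
  next
    assume p: "A (fst p) = 0 \<and> snd p \<in> D"
    then have "Q (snd p) \<in> D"
      using subspace_diff[OF sD _ Q_diff[of "snd p"]] by fastforce
    then have "Q (snd p) = 0" using Q_in inter_orthogonal_comp_subset by blast
    then show "T p = 0" using p by (simp add: T_def B.zero)
  qed
  define L where "L = {p. T p = 0}\<^sup>\<bottom>"
  have L_iff: "(u, v) \<in> L \<longleftrightarrow> u \<in> Ap \<and> v \<in> D\<^sup>\<bottom>" for u v
  proof
    assume L: "(u, v) \<in> L"
    have "w \<bullet> u = 0" if "A w = 0" for w
      using orthogonal_compD(2)[OF L[unfolded L_def], of "(w, 0)"] that subspace_0[OF sD]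
      by (simp add: ker_T)
    moreover have "w \<bullet> v = 0" if "w \<in> D" for w
      using orthogonal_compD(2)[OF L[unfolded L_def], of "(0, w)"] that by (simp add: ker_T A.zero)
    ultimately show "u \<in> Ap \<and> v \<in> D\<^sup>\<bottom>"
      unfolding Ap_def by (auto intro: orthogonal_compI)
  next
    assume "u \<in> Ap \<and> v \<in> D\<^sup>\<bottom>"
    then show "(u, v) \<in> L"
      unfolding Ap_def L_def by (auto intro!: orthogonal_compI simp: ker_T orthogonal_compD(2))
  qed
  have T_L: "T (u, v) = A u + B v" if "(u, v) \<in> L" for u v
    using that by (simp add: T_def L_iff Q_same)
  have range_T: "range T = M + N"
  proof (intro antisym subsetI)
    fix z assume "z \<in> M + N"
    then obtain u v where z: "z = A u + B v" unfolding M N by (auto elim: set_plus_elim)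
    \<comment> \<open>The part of \<open>v\<close> removed by \<open>Q\<close> has its image in
      \<open>M\<close>, so the first component can absorb it.\<close>
    obtain w where w: "B (v - Q v) = A w"
      using Q_diff[of v] by (auto simp: D_iff M)
    have "z = T (u + w, v)"
      using w by (simp add: z T_def A.add B.diff algebra_simps)
    then show "z \<in> range T" by blast
  qed (auto simp: T_def M N)

  obtain X U where X: "bounded_linear X" "\<And>x y. X x \<bullet> y = x \<bullet> X y" "\<And>x. 0 \<le> X x \<bullet> x"
    and X_comm: "\<And>J x. bounded_linear J \<Longrightarrow> (\<And>x. J (T (adjoint T x)) = T (adjoint T (J x)))
      \<Longrightarrow> J (X x) = X (J x)"
    and clX: "closure (range X) = K" and X_inj: "inj_on X K" and X_K: "X ` K = range X"
    and U_L: "U ` L = K" and XU: "\<And>l. l \<in> L \<Longrightarrow> X (U l) = T l"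
    and U_inner: "\<And>l l'. l \<in> L \<Longrightarrow> l' \<in> L \<Longrightarrow> U l \<bullet> U l' = l \<bullet> l'"
    using polar_decomposition[OF T] unfolding range_T K_def[symmetric] L_def[symmetric] by blast
  interpret X: bounded_linear X by (rule X)
  \<comment> \<open>Scaling by \<open>c\<close> commutes with \<open>T\<close> and its adjoint,
    hence with the root.\<close>
  have Xc: "X (c *\<^sub>C x) = c *\<^sub>C X x" for c x
    by (rule X_comm[symmetric, OF bounded_linear_scaleC]) (simp add: Tc adjoint_scaleC[OF T Tc])
  have U_in: "l \<in> L \<Longrightarrow> U l \<in> K" for l using U_L by blast
  have XU': "X (U (u, v)) = A u + B v" if "(u, v) \<in> L" for u v
    using that by (simp add: XU T_L)
  have csK: "csubspace K"
  proof -
    have "csubspace (range T)" by (rule csubspace_image[OF T Tc complex_vector.subspace_UNIV])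
    then show ?thesis
      using csubspace_orthogonal_comp[OF csubspace_orthogonal_comp]
        orthogonal_comp_orthogonal_comp_closure csubspace_imp_subspace
      unfolding K_def range_T[symmetric] by metis
  qed
  note sK = csubspace_imp_subspace[OF csK]
  have clK: "closed K" by (simp add: K_def)

  \<comment> \<open>Under \<open>U\<close>, the sets \<open>S\<close>, \<open>K3\<close> and
    \<open>F\<close> correspond to \<open>(E \<inter> Ap) \<times> {0}\<close>, to
    \<open>{0}\<close> times the complement of \<open>D\<close>, and to the complement of
    \<open>E\<close> times \<open>{0}\<close>. Writing \<open>F\<close> with complements makes it
    closed at once.\<close>
  define S where "S = K \<inter> X -` (M \<inter> N)"
  define K3 where "K3 = K \<inter> X -` (B ` (D\<^sup>\<bottom>))"
  define F where "F = K \<inter> (S\<^sup>\<bottom> \<inter> K3\<^sup>\<bottom>)"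
  define P0 where "P0 = orth_proj F"
  have csS: "csubspace S"
    unfolding S_def
    by (intro complex_vector.subspace_inter csK csubspace_vimage[OF X(1) Xc] csMN)
  have "csubspace (B ` (D\<^sup>\<bottom>))"
    by (rule csubspace_image[OF B csDp])
  then have csK3: "csubspace K3"
    unfolding K3_def by (intro complex_vector.subspace_inter csK csubspace_vimage[OF X(1) Xc])
  have csF: "csubspace F"
    unfolding F_def by (intro complex_vector.subspace_inter csK csubspace_orthogonal_comp csS csK3)
  have clF: "closed F"
    unfolding F_def by (intro closed_Int clK closed_orthogonal_comp)
  note sF = csubspace_imp_subspace[OF csF]
  have "range X \<subseteq> M + N"
    unfolding X_K[symmetric] U_L[symmetric] using XU range_T by auto
  then have clS: "closed S"
    unfolding S_def by (intro closed_Int clK closed_vimage_inter[OF X(1) _ assms(4)])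

  \<comment> \<open>The splitting \<open>u = u1 + u2\<close> along \<open>E\<close> gives
    \<open>k = k1 + k2 + k3\<close> with \<open>k1\<close> in \<open>F\<close>, \<open>k2\<close> in
    \<open>S\<close> and \<open>k3\<close> in \<open>K3\<close>. Hence \<open>P0 k = k1\<close>,
    whose image is \<open>A u1\<close>, and the rest maps to \<open>A u2 + B v\<close> with both
    terms in \<open>N\<close>.\<close>
  have P0: "X (P0 k) \<in> M" "X (k - P0 k) \<in> N" if k: "k \<in> K" for k
  proof -
    obtain u v where L: "(u, v) \<in> L" and k_U: "k = U (u, v)"
      using k U_L by (metis imageE surj_pair)
    define u1 where "u1 = orth_proj (E\<^sup>\<bottom>) u"
    define u2 where "u2 = u - u1"
    note Ep = subspace_orthogonal_comp[of E] closed_orthogonal_comp[of E]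
    have u1: "u1 \<in> E\<^sup>\<bottom>" unfolding u1_def by (rule orth_proj_in[OF Ep])
    have u2: "u2 \<in> E"
      using orth_proj_diff[OF Ep, of u] by (simp add: u1_def u2_def orthogonal_comp_orthogonal_comp sE clE)
    have "u1 \<in> Ap" using u1 E_Ap by blast
    moreover have "u2 \<in> Ap" using calculation L sAp by (simp add: u2_def L_iff subspace_diff)
    ultimately have L123: "(u1, 0) \<in> L" "(u2, 0) \<in> L" "(0, v) \<in> L"
      using L sAp sDp by (simp_all add: L_iff subspace_0)
    define k1 k2 k3 where k_defs: "k1 = U (u1, 0)" "k2 = U (u2, 0)" "k3 = U (0, v)"
    have kK: "k1 \<in> K" "k2 \<in> K" "k3 \<in> K" using L123 U_in by (simp_all add: k_defs)
    have Xk: "X k1 = A u1" "X k2 = A u2" "X k3 = B v" "X k = A u + B v"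
      using L123 L by (simp_all add: k_defs k_U XU' A.zero B.zero)
    \<comment> \<open>Both sides have the same image under \<open>X\<close>, which is injective on
      \<open>K\<close>; additivity of \<open>U\<close> is not at hand.\<close>
    have k_sum: "k = k1 + (k2 + k3)"
      by (rule inj_onD[OF X_inj])
        (use kK k sK in \<open>simp_all add: X.add Xk subspace_add u2_def A.diff\<close>)
    have k2S: "k2 \<in> S" using kK u2 by (simp add: S_def Xk E_def)
    have k3K: "k3 \<in> K3" using kK L by (simp add: K3_def Xk L_iff)
    have "k1 \<in> F"
      unfolding F_def
    proof (intro IntI orthogonal_compI)
      fix s assume s: "s \<in> S"
      then obtain u' v' where L': "(u', v') \<in> L" and s_U: "s = U (u', v')"
        using U_L unfolding S_def by (metis IntD1 imageE surj_pair)
      have Xs: "A u' + B v' \<in> M" "A u' + B v' \<in> N"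
        using s L' by (simp_all add: S_def s_U XU')
      \<comment> \<open>Hence \<open>v'\<close> is in both \<open>D\<close> and its complement and
        vanishes; then \<open>u'\<close> is in \<open>E\<close>, to which \<open>u1\<close> is
        orthogonal.\<close>
      have "B v' \<in> M"
        using subspace_diff[OF sM Xs(1), of "A u'"] by (simp add: M)
      then have v': "v' = 0"
        using L' inter_orthogonal_comp_subset[of D] by (auto simp: L_iff D_iff)
      then have "u' \<in> E" using Xs(2) by (simp add: E_iff B.zero)
      then show "s \<bullet> k1 = 0"
        using U_inner[OF L' L123(1)] u1 by (simp add: s_U k_defs orthogonal_compD(2))
    next
      fix s assume s: "s \<in> K3"
      then obtain v' where v': "v' \<in> D\<^sup>\<bottom>" "X s = B v'" unfolding K3_def by blast
      then have L': "(0, v') \<in> L" using subspace_0[OF sAp] by (simp add: L_iff)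
      have "s = U (0, v')"
        by (rule inj_onD[OF X_inj]) (use s v' L' U_in in \<open>simp_all add: XU' A.zero K3_def\<close>)
      then show "s \<bullet> k1 = 0"
        using U_inner[OF L' L123(1)] by (simp add: k_defs)
    qed (rule kK)
    moreover have "k2 + k3 \<in> F\<^sup>\<bottom>"
    proof (rule orthogonal_compI)
      fix f assume "f \<in> F"
      then show "f \<bullet> (k2 + k3) = 0"
        using k2S k3K orthogonal_compD(1)[of f S k2] orthogonal_compD(1)[of f K3 k3]
        by (simp add: F_def inner_add_right)
    qed
    ultimately have P0_k: "P0 k = k1"
      unfolding P0_def by (intro orth_proj_unique[OF sF clF]) (simp_all add: k_sum)
    show "X (P0 k) \<in> M" by (simp add: P0_k Xk M)
    have "X (k - P0 k) = A u2 + B v" by (simp add: P0_k X.diff Xk u2_def A.diff)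
    then show "X (k - P0 k) \<in> N"
      using u2 subspace_add[OF sN, of "A u2" "B v"] by (simp add: E_iff N)
  qed
  \<comment> \<open>Projecting \<open>u\<close> onto the complement of the kernel of
    \<open>A\<close> keeps \<open>A u\<close> and puts \<open>(u', 0)\<close> into \<open>L\<close>,
    where \<open>U\<close> supplies the preimage.\<close>
  have S_onto: "\<exists>s\<in>S. X s = m" if m: "m \<in> M \<inter> N" for m
  proof -
    obtain u where u: "m = A u" using m M by blast
    note Apc = subspace_orthogonal_comp[of "{u. A u = 0}"] closed_orthogonal_comp[of "{u. A u = 0}"]
    define u' where "u' = orth_proj Ap u"
    have "u - u' \<in> {u. A u = 0}\<^sup>\<bottom>\<^sup>\<bottom>"
      unfolding u'_def Ap_def by (rule orth_proj_diff[OF Apc])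
    moreover have "{u. A u = 0}\<^sup>\<bottom>\<^sup>\<bottom> = {u. A u = 0}"
      by (rule orthogonal_comp_orthogonal_comp)
        (auto simp: subspace_def A.zero A.add A.scale intro!: closed_Collect_eq continuous_intros
          A.continuous_on)
    ultimately have "A u' = m" by (simp add: u A.diff)
    moreover have L: "(u', 0) \<in> L"
      using orth_proj_in[OF Apc] subspace_0[OF sDp] by (simp add: L_iff u'_def Ap_def)
    ultimately have "X (U (u', 0)) = m" by (simp add: XU' B.zero)
    then show ?thesis using U_in[OF L] m unfolding S_def by blast
  qed
  have F_K: "F \<subseteq> K" by (simp add: F_def)
  have P0_F: "P0 k \<in> F" for k unfolding P0_def by (rule orth_proj_in[OF sF clF])

  show ?thesis
  proof (intro exI conjI)
    show X_op: "bounded_operator_on K X"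
      using X_K clX closure_subset[of "range X"] by (intro bounded_operator_onI X Xc) simp
    show "positive_on K X" by (intro positive_onI X Xc)
    show "quasi_affinity_on K X"
      using X_op X_inj clX X_K by (simp add: quasi_affinity_on_def)
    have P0c: "P0 (c *\<^sub>C x) = c *\<^sub>C P0 x" for c x
      unfolding P0_def by (rule orth_proj_scaleC[OF csF clF])
    show "bounded_operator_on K P0"
      using P0_F F_K
      by (intro bounded_operator_onI P0c) (auto simp: P0_def bounded_linear_orth_proj sF clF)
    show "positive_on K P0"
      unfolding P0_def
      by (intro positive_onI P0c[unfolded P0_def] orth_proj_symmetric[OF sF clF])
        (simp only: orth_proj_inner[OF sF clF] zero_le_power2)
    show "idempotent_on K P0"
      using orth_proj_same[OF sF clF] P0_F by (simp add: idempotent_on_def P0_def)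
    show "csubspace S" "closed S" by (rule csS clS)+
    show "S \<subseteq> K" by (simp add: S_def)
    \<comment> \<open>Membership in \<open>F\<close> gives real orthogonality to \<open>S\<close>,
      which upgrades to complex orthogonality because \<open>S\<close> is a complex
      subspace.\<close>
    have "cinner (P0 k) s = 0" if "s \<in> S" for k s
      using cinner_eq_0_if_orthogonal_comp[OF csS _ that, of "P0 k"] P0_F by (auto simp: F_def)
    moreover have "cinner x 0 = 0" for x :: 'a
      by (simp add: complex_eq_iff Re_cinner Im_cinner)
    ultimately show "corthogonal_sets (graph_on K P0) ({0} \<times> S)"
      by (auto simp: corthogonal_sets_def graph_on_def cinner_prod_def)
    show "proj_rel M N \<bullet>\<^sub>r graph_on K X = graph_on K X \<bullet>\<^sub>r (graph_on K P0 + {0} \<times> S)"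
    proof (intro equalityI subrelI)
      fix k m assume "(k, m) \<in> proj_rel M N \<bullet>\<^sub>r graph_on K X"
      then obtain n where k: "k \<in> K" and m: "m \<in> M" and n: "n \<in> N" and mn: "X k = m + n"
        by (auto simp: rel_product_def proj_rel_def graph_on_def)
      \<comment> \<open>The left side lies in \<open>M\<close> and the right side in
        \<open>N\<close>, so the discrepancy between \<open>m\<close> and \<open>X (P0 k)\<close> is
        the image of some element of \<open>S\<close>.\<close>
      have "m - X (P0 k) = X (k - P0 k) - n" using mn by (simp add: X.diff algebra_simps)
      then have "m - X (P0 k) \<in> M \<inter> N"
        using P0[OF k] m n by (metis IntI subspace_diff sM sN)
      then obtain s where s: "s \<in> S" "X s = m - X (P0 k)" using S_onto by blast
      have "(k, P0 k) + (0, s) \<in> graph_on K P0 + {0} \<times> S"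
        using k s by (intro set_plus_intro) (auto simp: graph_on_def)
      moreover have "(P0 k + s, m) \<in> graph_on K X"
        using s P0_F F_K sK by (auto simp: graph_on_def X.add S_def intro!: subspace_add)
      ultimately show "(k, m) \<in> graph_on K X \<bullet>\<^sub>r (graph_on K P0 + {0} \<times> S)"
        unfolding rel_product_def by auto
    next
      fix k m assume "(k, m) \<in> graph_on K X \<bullet>\<^sub>r (graph_on K P0 + {0} \<times> S)"
      then obtain s where k: "k \<in> K" and s: "s \<in> S" and m: "m = X (P0 k + s)"
        by (auto simp: rel_product_def graph_on_def elim!: set_plus_elim)
      have Xs: "X s \<in> M" "X s \<in> N" using s by (simp_all add: S_def)
      have "m \<in> M" using P0(1)[OF k] Xs sM by (simp add: m X.add subspace_add)
      \<comment> \<open>Here \<open>X k - m\<close> equals \<open>X (k - P0 k) - X s\<close>, and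
        both terms lie in \<open>N\<close>; it serves as the summand from \<open>N\<close>.\<close>
      moreover have "X k - m \<in> N"
        using subspace_diff[OF sN P0(2)[OF k] Xs(2)] by (simp add: m X.add X.diff algebra_simps)
      ultimately have "(m + (X k - m), m) \<in> proj_rel M N" unfolding proj_rel_def by blast
      then show "(k, m) \<in> proj_rel M N \<bullet>\<^sub>r graph_on K X"
        using k by (auto simp: rel_product_def graph_on_def)
    qed
  qed
qed

end
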